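(* Consider any infinite sequence of rational interval forecasts and outcomes $\upsilon=(\iota,\omega)\in(\mathcal{I}_r\times\{0,1\})^{\mathbb{N}}$ that is game-random. Then the infinite sequence of outcomes $\omega$ is Martin-Löf random for any rational forecasting system $\varphi_r$ that is compatible with $\upsilon$.
   Context: Let $\mathcal{X}=\{0,1\}$, $\mathbb{N}=\{1,2,\dots\}$ and $\mathbb{N}_0=\mathbb{N}\cup\{0\}$. An interval forecast is a non-empty closed interval $I\subseteq[0,1]$ (possibly a single point); $\mathcal{I}_r$ is the set of all interval forecasts with rational endpoints. For an interval forecast $I$ and $f\colon\mathcal{X}\to\mathbb{R}$, the upper expectation is $\overline{E}_I(f)=\max_{p\in I}[pf(1)+(1-p)f(0)]$. Situations are the elements $w$ of $\mathcal{X}^*=\bigcup_{k\in\mathbb{N}_0}\mathcal{X}^k$; $\square$ is the empty situation and $wx$ is the concatenation of $w$ with $x\in\mathcal{X}$. A path is an element $\omega=(\omega_1,\omega_2,\dots)\in\mathcal{X}^{\mathbb{N}}$, with prefixes $\omega_{1:n}$ of length $n$. Prequential situations are the elements $v=(I_1,x_1,\dots,I_n,x_n)$ of $(\mathcal{I}_r\times\mathcal{X})^*=\bigcup_{k\in\mathbb{N}_0}(\mathcal{I}_r\times\mathcal{X})^k$, with the empty one also denoted $\square$; $vI_rx$ is the concatenation of $v$ with $I_r\in\mathcal{I}_r$ and $x\in\mathcal{X}$. A prequential path is $\upsilon=(I_1,x_1,I_2,x_2,\dots)\in(\mathcal{I}_r\times\mathcal{X})^{\mathbb{N}}$, identified with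 the pair $(\iota,\omega)$ where $\iota=(I_1,I_2,\dots)$ and $\omega=(x_1,x_2,\dots)$; $\upsilon_{1:n}=(I_1,x_1,\dots,I_n,x_n)$. It is non-degenerate if $\iota_n\neq\{1-\omega_n\}$ for all $n\in\mathbb{N}$. A rational forecasting system is a map $\varphi_r\colon\mathcal{X}^*\to\mathcal{I}_r$ (no computability is required). It is compatible with $\upsilon=(\iota,\omega)$ if $\varphi_r(\omega_{1:n})=\iota_{n+1}$ for all $n\in\mathbb{N}_0$. A map $r\colon\mathcal{D}\to\mathbb{R}$ on a countable encoded set $\mathcal{D}$ is lower semicomputable if there is a recursive (Turing-computable, via encodings) map $q\colon\mathcal{D}\times\mathbb{N}_0\to\mathbb{Q}$ with $q(d,n)\leq q(d,n+1)$ and $\lim_{m\to\infty}q(d,m)=r(d)$ for all $d,n$. A test supermartingale for $\varphi_r$ is a map $T\colon\mathcal{X}^*\to\mathbb{R}$ with $T\geq0$, $T(\square)=1$ and $\overline{E}_{\varphi_r(w)}(T(w\,\cdot))\leq T(w)$ for all $w\in\mathcal{X}^*$, where $T(w\,\cdot)$ is the map $x\mapsto T(wx)$. A path $\omega$ is Martin-Löf random for $\varphi_r$ if $\limsup_{n\to\infty}T(\omega_{1:n})<\infty$ for all lower semicomputable test supermartingales $T$ for $\varphi_r$. A test superfarthingale is a map $F\colon(\mathcal{I}_r\times\mathcal{X})^*\to\mathbb{R}$ with $F\geq0$, $F(\square)=1$ and $\overline{E}_{I_r}(F(vI_r\,\cdot))\leq F(v)$ for all prequential situations $v$ and all $I_r\in\mathcal{I}_r$,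 where $F(vI_r\,\cdot)$ is the map $x\mapsto F(vI_rx)$. A prequential path $\upsilon$ is game-random if it is non-degenerate and all lower semicomputable test superfarthingales $F$ satisfy $\limsup_{n\to\infty}F(\upsilon_{1:n})<\infty$. *)

theory Defs
  imports Complex_Main "HOL-Library.Nat_Bijection" "HOL-Library.Extended_Real"
begin

section \<open>Recursive functions\<close>

text \<open>
  Kleene's total recursive functions. In \<open>recursive k f\<close> only the values of \<open>f\<close> on
  lists of length \<open>k\<close> are meaningful. Minimization is restricted to regular functions,
  so every function of the class is total.
\<close>

inductive recursive :: "nat \<Rightarrow> (nat list \<Rightarrow> nat) \<Rightarrow> bool" where
  zero: "recursive k (\<lambda>xs. 0)"
| succ: "recursive 1 (\<lambda>xs. Suc (hd xs))"
| proj: "i < k \<Longrightarrow> recursive k (\<lambda>xs. xs ! i)"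
| comp: "recursive (length gs) f \<Longrightarrow> (\<forall>g\<in>set gs. recursive k g) \<Longrightarrow>
    recursive k (\<lambda>xs. f (map (\<lambda>g. g xs) gs))"
| prim_rec: "recursive k f \<Longrightarrow> recursive (Suc (Suc k)) g \<Longrightarrow>
    recursive (Suc k) (\<lambda>xs. rec_nat (f (tl xs)) (\<lambda>y z. g (y # z # tl xs)) (hd xs))"
| mu: "recursive (Suc k) f \<Longrightarrow> (\<forall>xs. length xs = k \<longrightarrow> (\<exists>y. f (y # xs) = 0)) \<Longrightarrow>
    recursive k (\<lambda>xs. LEAST y. f (y # xs) = 0)"

definition recursive_map :: "('a \<Rightarrow> nat) \<Rightarrow> ('b \<Rightarrow> nat) \<Rightarrow> ('a \<Rightarrow> 'b) \<Rightarrow> bool" where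
  "recursive_map enc_a enc_b f \<longleftrightarrow>
    (\<exists>g. recursive 1 g \<and> (\<forall>x. g [enc_a x] = enc_b (f x)))"

definition rat_encode :: "rat \<Rightarrow> nat" where
  "rat_encode r = (case quotient_of r of (a, b) \<Rightarrow> prod_encode (int_encode a, nat b))"

definition lower_semicomputable :: "('d \<Rightarrow> nat) \<Rightarrow> ('d \<Rightarrow> real) \<Rightarrow> bool" where
  "lower_semicomputable enc r \<longleftrightarrow>
    (\<exists>q :: 'd \<times> nat \<Rightarrow> rat.
       recursive_map (\<lambda>(d, n). prod_encode (enc d, n)) rat_encode q \<and>
       (\<forall>d n. q (d, n) \<le> q (d, Suc n)) \<and>
       (\<forall>d. (\<lambda>m. real_of_rat (q (d, m))) \<longlonglongrightarrow> r d))"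


section \<open>Rational interval forecasts\<close>

text \<open>A rational interval forecast is represented by its two endpoints.\<close>

typedef rforecast = "{(a, b). 0 \<le> a \<and> a \<le> b \<and> b \<le> (1::rat)}"
  by (rule exI[of _ "(0, 1)"]) simp

definition lower_end :: "rforecast \<Rightarrow> rat" where
  "lower_end I = fst (Rep_rforecast I)"

definition upper_end :: "rforecast \<Rightarrow> rat" where
  "upper_end I = snd (Rep_rforecast I)"

definition interval :: "rforecast \<Rightarrow> real set" where
  "interval I = {real_of_rat (lower_end I) .. real_of_rat (upper_end I)}"

text \<open>
  Outcomes are Booleans, with \<open>True\<close> for \<open>1\<close> and \<open>False\<close> for \<open>0\<close>. The supremum below is
  a maximum, see \<open>upper_expectation_attained\<close>.
\<close>

definition upper_expectation :: "rforecast \<Rightarrow> (bool \<Rightarrow> real) \<Rightarrow> real" where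
  "upper_expectation I f = (SUP p\<in>interval I. p * f True + (1 - p) * f False)"


section \<open>Situations and paths\<close>

type_synonym situation = "bool list"
type_synonym preq_situation = "(rforecast \<times> bool) list"
type_synonym forecasting_system = "situation \<Rightarrow> rforecast"

text \<open>
  Paths are indexed from \<open>0\<close>: the value at \<open>n\<close> is the entry number \<open>n + 1\<close> of the path,
  and \<open>initial p n\<close> consists of its first \<open>n\<close> entries.
\<close>

type_synonym path = "nat \<Rightarrow> bool"
type_synonym preq_path = "nat \<Rightarrow> rforecast \<times> bool"

definition initial :: "(nat \<Rightarrow> 'a) \<Rightarrow> nat \<Rightarrow> 'a list" where
  "initial p n = map p [0..<n]"

definition situation_encode :: "situation \<Rightarrow> nat" where
  "situation_encode w = list_encode (map of_bool w)"

definition rforecast_encode :: "rforecast \<Rightarrow> nat" where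
  "rforecast_encode I = prod_encode (rat_encode (lower_end I), rat_encode (upper_end I))"

definition preq_situation_encode :: "preq_situation \<Rightarrow> nat" where
  "preq_situation_encode v =
    list_encode (map (\<lambda>(I, x). prod_encode (rforecast_encode I, of_bool x)) v)"

definition non_degenerate :: "preq_path \<Rightarrow> bool" where
  "non_degenerate \<upsilon> \<longleftrightarrow> (\<forall>n. interval (fst (\<upsilon> n)) \<noteq> {1 - of_bool (snd (\<upsilon> n))})"

definition compatible :: "forecasting_system \<Rightarrow> preq_path \<Rightarrow> bool" where
  "compatible \<phi> \<upsilon> \<longleftrightarrow> (\<forall>n. \<phi> (initial (snd \<circ> \<upsilon>) n) = fst (\<upsilon> n))"


section \<open>Randomness\<close>

definition test_supermartingale :: "forecasting_system \<Rightarrow> (situation \<Rightarrow> real) \<Rightarrow> bool" where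
  "test_supermartingale \<phi> T \<longleftrightarrow>
    (\<forall>w. T w \<ge> 0) \<and> T [] = 1 \<and>
    (\<forall>w. upper_expectation (\<phi> w) (\<lambda>x. T (w @ [x])) \<le> T w)"

definition martin_loef_random :: "forecasting_system \<Rightarrow> path \<Rightarrow> bool" where
  "martin_loef_random \<phi> \<omega> \<longleftrightarrow>
    (\<forall>T. test_supermartingale \<phi> T \<and> lower_semicomputable situation_encode T \<longrightarrow>
      limsup (\<lambda>n. ereal (T (initial \<omega> n))) < \<infinity>)"

definition test_superfarthingale :: "(preq_situation \<Rightarrow> real) \<Rightarrow> bool" where
  "test_superfarthingale F \<longleftrightarrow>
    (\<forall>v. F v \<ge> 0) \<and> F [] = 1 \<and>
    (\<forall>v I. upper_expectation I (\<lambda>x. F (v @ [(I, x)])) \<le> F v)"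

definition game_random :: "preq_path \<Rightarrow> bool" where
  "game_random \<upsilon> \<longleftrightarrow> non_degenerate \<upsilon> \<and>
    (\<forall>F. test_superfarthingale F \<and> lower_semicomputable preq_situation_encode F \<longrightarrow>
      limsup (\<lambda>n. ereal (F (initial \<upsilon> n))) < \<infinity>)"


section \<open>Basic facts\<close>

lemma rforecast_ends: "0 \<le> lower_end I" "lower_end I \<le> upper_end I" "upper_end I \<le> 1"
  using Rep_rforecast[of I] by (auto simp: lower_end_def upper_end_def)

lemma rforecast_eqI: "lower_end I = lower_end J \<Longrightarrow> upper_end I = upper_end J \<Longrightarrow> I = J"
  by (simp add: lower_end_def upper_end_def Rep_rforecast_inject[symmetric] prod_eq_iff)

lemma ex_rforecast_interval:
  assumes "0 \<le> a" "a \<le> b" "b \<le> 1"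
  shows "\<exists>I. interval I = {real_of_rat a .. real_of_rat b}"
  using assms by (intro exI[of _ "Abs_rforecast (a, b)"])
    (simp add: interval_def lower_end_def upper_end_def Abs_rforecast_inverse)

lemma inj_interval: "inj interval"
proof (rule injI)
  fix I J assume "interval I = interval J"
  then show "I = J"
    using rforecast_ends(2)[of I] rforecast_ends(2)[of J]
    by (intro rforecast_eqI) (auto simp: interval_def of_rat_less_eq Icc_eq_Icc)
qed

lemma upper_expectation_attained:
  "\<exists>p\<in>interval I. upper_expectation I f = p * f True + (1 - p) * f False \<and>
     (\<forall>p'\<in>interval I. p' * f True + (1 - p') * f False \<le> upper_expectation I f)"
proof -
  let ?g = "\<lambda>p::real. p * f True + (1 - p) * f False"
  have "compact (interval I)" "interval I \<noteq> {}"
    using rforecast_ends(2)[of I] by (auto simp: interval_def of_rat_less_eq)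
  moreover have "continuous_on (interval I) ?g"
    by (intro continuous_intros)
  ultimately have "\<exists>p\<in>interval I. \<forall>p'\<in>interval I. ?g p' \<le> ?g p"
    by (rule continuous_attains_sup)
  then obtain p where p: "p \<in> interval I" "\<forall>p'\<in>interval I. ?g p' \<le> ?g p"
    by blast
  have "upper_expectation I f = ?g p"
    unfolding upper_expectation_def
    by (rule cSup_eq_maximum) (use p in auto)
  then show ?thesis using p by auto
qed

lemma inj_rat_encode: "inj rat_encode"
proof (rule injI)
  fix r s assume eq: "rat_encode r = rat_encode s"
  obtain a b where r: "quotient_of r = (a, b)" by force
  obtain c d where s: "quotient_of s = (c, d)" by force
  have "b > 0" "d > 0" using r s quotient_of_denom_pos by auto
  then have "a = c" "b = d" using eq r s by (auto simp: rat_encode_def int_encode_eq)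
  then show "r = s" using r s by (metis quotient_of_inject)
qed

lemma inj_situation_encode: "inj situation_encode"
proof -
  have "inj (of_bool :: bool \<Rightarrow> nat)"
    by (rule injI) (simp add: of_bool_def split: if_splits)
  then show ?thesis
    by (intro injI) (simp add: situation_encode_def list_encode_eq inj_map_eq_map)
qed

lemma inj_rforecast_encode: "inj rforecast_encode"
  by (rule injI) (auto simp: rforecast_encode_def inj_eq[OF inj_rat_encode] intro: rforecast_eqI)

lemma inj_preq_situation_encode: "inj preq_situation_encode"
proof -
  have "inj (\<lambda>(I, x). prod_encode (rforecast_encode I, of_bool x))"
    by (rule injI) (auto simp: inj_eq[OF inj_rforecast_encode] of_bool_def split: if_splits)
  then show ?thesis
    by (intro injI) (simp add: preq_situation_encode_def list_encode_eq inj_map_eq_map)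
qed

end

theory Submission
  imports Defs
begin

text \<open>
  Let rational \<open>q\<^sub>j\<close> increase to a test supermartingale \<open>T\<close>, and let \<open>r\<^sub>j\<close> be the positive part of
  \<open>q\<^sub>j\<close>, scaled by \<open>j / (j + 1)\<close>. Define \<open>F\<^sub>m\<close> by \<open>F\<^sub>m(\<box>) = 1\<close> and \<open>F\<^sub>m(vIx) = r\<^sub>j(wx)\<close>, where \<open>w\<close>
  consists of the outcomes in \<open>v\<close> and \<open>j\<close> is the largest index up to \<open>m\<close> for which the upper
  expectation of \<open>r\<^sub>j(w\<cdot>)\<close> under \<open>I\<close> does not exceed \<open>F\<^sub>m(v)\<close> (and \<open>F\<^sub>m(vIx) = 0\<close> if there is none).
  This uses only the forecasts in \<open>v\<close>, so no computability of the forecasting system is needed.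
  The \<open>F\<^sub>m\<close> are superfarthingales, computable uniformly in \<open>m\<close>, and increase with \<open>m\<close>; their limit
  is a lower semicomputable test superfarthingale. The scaling makes each \<open>r\<^sub>j\<close> eventually pass
  the test along a path compatible with the forecasting system, where the limit thus equals \<open>T\<close>.
\<close>

section \<open>Computable functions\<close>

text \<open>The constructors of \<open>recursive\<close> fix a function on lists of every length,
  although only lists of length \<open>k\<close> matter. Asking for agreement on those lists alone
  lets functions be rewritten freely.\<close>

definition recursive_on :: "nat \<Rightarrow> (nat list \<Rightarrow> nat) \<Rightarrow> bool" where
  "recursive_on k f \<longleftrightarrow> (\<exists>f'. recursive k f' \<and> (\<forall>xs. length xs = k \<longrightarrow> f' xs = f xs))"

lemma recursive_onI: "recursive k f \<Longrightarrow> recursive_on k f"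
  unfolding recursive_on_def by blast

lemma recursive_on_cong:
  assumes "recursive_on k f" "\<And>xs. length xs = k \<Longrightarrow> f xs = g xs"
  shows "recursive_on k g"
  using assms unfolding recursive_on_def by metis

lemma recursive_on_comp:
  assumes f: "recursive_on (length gs) f" and gs: "\<And>g. g \<in> set gs \<Longrightarrow> recursive_on k g"
  shows "recursive_on k (\<lambda>xs. f (map (\<lambda>g. g xs) gs))"
proof -
  obtain f' where f': "recursive (length gs) f'" "\<And>xs. length xs = length gs \<Longrightarrow> f' xs = f xs"
    using f unfolding recursive_on_def by blast
  have "\<forall>g\<in>set gs. \<exists>g'. recursive k g' \<and> (\<forall>xs. length xs = k \<longrightarrow> g' xs = g xs)"
    using gs unfolding recursive_on_def by blast
  then obtain h where h: "\<And>g. g \<in> set gs \<Longrightarrow> recursive k (h g)"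
    "\<And>g xs. g \<in> set gs \<Longrightarrow> length xs = k \<Longrightarrow> h g xs = g xs"
    by metis
  have "recursive k (\<lambda>xs. f' (map (\<lambda>g. g xs) (map h gs)))"
    using f'(1) h(1) by (intro recursive.comp) auto
  moreover have "f' (map (\<lambda>g. g xs) (map h gs)) = f (map (\<lambda>g. g xs) gs)" if "length xs = k" for xs
  proof -
    have "map (\<lambda>g. g xs) (map h gs) = map (\<lambda>g. g xs) gs"
      using h(2) that by simp
    then show ?thesis using f'(2)[of "map (\<lambda>g. g xs) gs"] by (simp only: length_map)
  qed
  ultimately show ?thesis
    unfolding recursive_on_def by blast
qed

lemma recursive_on_prim_rec:
  assumes "recursive_on k f" "recursive_on (Suc (Suc k)) g"
  shows "recursive_on (Suc k)
    (\<lambda>xs. rec_nat (f (tl xs)) (\<lambda>y z. g (y # z # tl xs)) (hd xs))"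
proof -
  obtain f' g' where f': "recursive k f'" "\<And>xs. length xs = k \<Longrightarrow> f' xs = f xs"
    and g': "recursive (Suc (Suc k)) g'" "\<And>xs. length xs = Suc (Suc k) \<Longrightarrow> g' xs = g xs"
    using assms unfolding recursive_on_def by blast
  show ?thesis
    by (rule recursive_on_cong[OF recursive_onI[OF recursive.prim_rec[OF f'(1) g'(1)]]])
      (simp add: f'(2) g'(2))
qed

lemma recursive_on_mu:
  assumes "recursive_on (Suc k) f" and reg: "\<And>xs. length xs = k \<Longrightarrow> \<exists>y. f (y # xs) = 0"
  shows "recursive_on k (\<lambda>xs. LEAST y. f (y # xs) = 0)"
proof -
  obtain f' where f': "recursive (Suc k) f'" "\<And>xs. length xs = Suc k \<Longrightarrow> f' xs = f xs"
    using assms(1) unfolding recursive_on_def by blast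
  have "recursive k (\<lambda>xs. LEAST y. f' (y # xs) = 0)"
    using f' reg by (intro recursive.mu) auto
  then show ?thesis
    by (rule recursive_on_cong[OF recursive_onI]) (simp add: f'(2))
qed

lemma recursive_on_const: "recursive_on k (\<lambda>xs. c)"
proof (induction c)
  case 0
  show ?case by (intro recursive_onI recursive.zero)
next
  case (Suc c)
  have "recursive_on (length [\<lambda>xs::nat list. c]) (\<lambda>xs. Suc (hd xs))"
    using recursive.succ by (simp add: recursive_onI)
  from recursive_on_comp[OF this, of k] Suc show ?case by simp
qed

lemma recursive_on_proj: "i < k \<Longrightarrow> recursive_on k (\<lambda>xs. xs ! i)"
  by (intro recursive_onI recursive.proj)

lemma recursive_on_comp1:
  assumes "recursive_on 1 (\<lambda>xs. f (xs ! 0))" "recursive_on k a"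
  shows "recursive_on k (\<lambda>xs. f (a xs))"
  using recursive_on_comp[of "[a]" "\<lambda>xs. f (xs ! 0)" k] assms by simp

text \<open>\<open>prim_rec\<close> hands only the tail of its argument list to the base and the
  step. Composing it with \<open>n\<close> followed by all \<open>k\<close> projections lets them
  see the whole list \<open>xs\<close>.\<close>

lemma recursive_on_rec_nat:
  assumes "recursive_on k a" "recursive_on (Suc (Suc k)) g" "recursive_on k n"
  shows "recursive_on k (\<lambda>xs. rec_nat (a xs) (\<lambda>y z. g (y # z # xs)) (n xs))"
proof -
  let ?ps = "map (\<lambda>i xs. xs ! i) [0..<k]"
  have "recursive_on (length (n # ?ps))
    (\<lambda>xs. rec_nat (a (tl xs)) (\<lambda>y z. g (y # z # tl xs)) (hd xs))"
    using recursive_on_prim_rec[OF assms(1,2)] by simp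
  moreover have "recursive_on k g" if "g \<in> set (n # ?ps)" for g
    using that assms(3) by (auto intro: recursive_on_proj)
  ultimately have "recursive_on k (\<lambda>xs. (\<lambda>xs. rec_nat (a (tl xs)) (\<lambda>y z. g (y # z # tl xs)) (hd xs))
      (map (\<lambda>g. g xs) (n # ?ps)))"
    by (rule recursive_on_comp)
  then have "recursive_on k (\<lambda>xs. rec_nat (a (map (\<lambda>g. g xs) ?ps))
      (\<lambda>y z. g (y # z # map (\<lambda>g. g xs) ?ps)) (n xs))"
    by (simp only: list.map list.sel)
  then show ?thesis
  proof (rule recursive_on_cong)
    fix xs :: "nat list" assume "length xs = k"
    then have "map (\<lambda>g. g xs) ?ps = xs"
      by (auto intro: nth_equalityI)
    then show "rec_nat (a (map (\<lambda>g. g xs) ?ps)) (\<lambda>y z. g (y # z # map (\<lambda>g. g xs) ?ps)) (n xs) =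
        rec_nat (a xs) (\<lambda>y z. g (y # z # xs)) (n xs)"
      by simp
  qed
qed

lemma recursive_on_Suc: "recursive_on k a \<Longrightarrow> recursive_on k (\<lambda>xs. Suc (a xs))"
  by (rule recursive_on_comp1[of Suc],
      rule recursive_on_cong[OF recursive_onI[OF recursive.succ]])
    (auto simp: length_Suc_conv)

lemma recursive_on_add:
  assumes "recursive_on k a" "recursive_on k b"
  shows "recursive_on k (\<lambda>xs. a xs + b xs)"
proof -
  have eq: "rec_nat m (\<lambda>y. Suc) n = m + n" for m n
    by (induction n) auto
  have "recursive_on k (\<lambda>xs. rec_nat (a xs) (\<lambda>y z. Suc ((y # z # xs) ! 1)) (b xs))"
    by (intro recursive_on_rec_nat recursive_on_Suc recursive_on_proj assms) simp
  then show ?thesis by (simp add: eq)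
qed

lemma recursive_on_pred:
  assumes "recursive_on k a"
  shows "recursive_on k (\<lambda>xs. a xs - 1)"
proof -
  have eq: "rec_nat 0 (\<lambda>y z. y) n = n - 1" for n :: nat
    by (cases n) auto
  have "recursive_on k (\<lambda>xs. rec_nat 0 (\<lambda>y z. (y # z # xs) ! 0) (a xs))"
    by (intro recursive_on_rec_nat recursive_on_const recursive_on_proj assms) simp
  then show ?thesis by (simp add: eq)
qed

lemma recursive_on_diff:
  assumes "recursive_on k a" "recursive_on k b"
  shows "recursive_on k (\<lambda>xs. a xs - b xs)"
proof -
  have eq: "rec_nat m (\<lambda>y z. z - 1) n = m - n" for m n :: nat
    by (induction n) auto
  have "recursive_on k (\<lambda>xs. rec_nat (a xs) (\<lambda>y z. (y # z # xs) ! 1 - 1) (b xs))"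
    by (intro recursive_on_rec_nat recursive_on_pred recursive_on_proj assms) simp
  then show ?thesis using eq by simp
qed

lemma recursive_on_triangle:
  assumes "recursive_on k a"
  shows "recursive_on k (\<lambda>xs. triangle (a xs))"
proof -
  have eq: "rec_nat 0 (\<lambda>y z. Suc (z + y)) n = triangle n" for n
    by (induction n) auto
  have "recursive_on k (\<lambda>xs. rec_nat 0 (\<lambda>y z. (y # z # xs) ! 1 + Suc ((y # z # xs) ! 0)) (a xs))"
    by (intro recursive_on_rec_nat[where g = "\<lambda>xs. xs ! 1 + Suc (xs ! 0)"] recursive_on_add
        recursive_on_Suc recursive_on_const recursive_on_proj assms) auto
  then show ?thesis by (simp add: eq)
qed

text \<open>A pair \<open>(m, n)\<close> has code \<open>triangle (m + n) + m\<close>. The least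
  \<open>s\<close> whose successor has a triangle number exceeding \<open>x\<close> is therefore
  \<open>m + n\<close>, so a single minimization inverts the pairing.\<close>

lemma prod_decode_by_triangle:
  defines "s \<equiv> \<lambda>x. LEAST s. Suc x - triangle (Suc s) = 0"
  shows "fst (prod_decode x) = x - triangle (s x)"
    and "snd (prod_decode x) = s x - (x - triangle (s x))"
proof -
  obtain m n where mn: "prod_decode x = (m, n)" by force
  then have x: "x = triangle (m + n) + m"
    using prod_decode_inverse[of x] by (simp add: prod_encode_def)
  have mono: "triangle i \<le> triangle j" if "i \<le> j" for i j
    using that by (induction rule: dec_induct) auto
  have "s x = m + n"
    unfolding s_def
  proof (rule Least_equality)
    fix t assume t: "Suc x - triangle (Suc t) = 0"
    show "m + n \<le> t"
    proof (rule ccontr)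
      assume "\<not> m + n \<le> t"
      then have "triangle (Suc t) \<le> triangle (m + n)" by (intro mono) simp
      with t x show False by simp
    qed
  qed (simp add: x)
  then show "fst (prod_decode x) = x - triangle (s x)"
    and "snd (prod_decode x) = s x - (x - triangle (s x))"
    using mn x by auto
qed

lemma recursive_on_prod_decode:
  assumes "recursive_on k a"
  shows "recursive_on k (\<lambda>xs. fst (prod_decode (a xs)))"
    and "recursive_on k (\<lambda>xs. snd (prod_decode (a xs)))"
proof -
  have "recursive_on 1 (\<lambda>xs. LEAST s. (\<lambda>xs. Suc (xs ! 1) - triangle (Suc (xs ! 0))) (s # xs) = 0)"
  proof (rule recursive_on_mu)
    show "recursive_on (Suc 1) (\<lambda>xs. Suc (xs ! 1) - triangle (Suc (xs ! 0)))"
      by (intro recursive_on_diff recursive_on_triangle recursive_on_Suc recursive_on_proj) auto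
    have "n \<le> triangle n" for n by (induction n) auto
    then show "\<exists>s. Suc ((s # xs) ! 1) - triangle (Suc ((s # xs) ! 0)) = 0" for xs
      by (intro exI[of _ "xs ! 0"]) (simp del: triangle_Suc)
  qed
  then have s: "recursive_on 1 (\<lambda>xs. LEAST s. Suc (xs ! 0) - triangle (Suc s) = 0)"
    by simp
  have x: "recursive_on 1 (\<lambda>xs. xs ! 0)"
    by (rule recursive_on_proj) simp
  show "recursive_on k (\<lambda>xs. fst (prod_decode (a xs)))"
    by (rule recursive_on_comp1[OF _ assms], unfold prod_decode_by_triangle)
      (intro recursive_on_diff recursive_on_triangle s x)
  show "recursive_on k (\<lambda>xs. snd (prod_decode (a xs)))"
    by (rule recursive_on_comp1[OF _ assms], unfold prod_decode_by_triangle)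
      (intro recursive_on_diff recursive_on_triangle s x)
qed

section \<open>Unary computability, with several arguments passed as one \<open>prod_encode\<close>
  code\<close>

definition computable :: "(nat \<Rightarrow> nat) \<Rightarrow> bool" where
  "computable f \<longleftrightarrow> (\<exists>g. recursive 1 g \<and> (\<forall>x. g [x] = f x))"

lemma computable_iff_recursive_on: "computable f \<longleftrightarrow> recursive_on 1 (\<lambda>xs. f (xs ! 0))"
proof -
  have "(\<forall>xs. length xs = 1 \<longrightarrow> P xs) \<longleftrightarrow> (\<forall>x::nat. P [x])" for P
    by (auto simp: length_Suc_conv)
  then show ?thesis
    unfolding computable_def recursive_on_def by simp
qed

lemma computable_comp: "computable f \<Longrightarrow> computable a \<Longrightarrow> computable (\<lambda>x. f (a x))"
  unfolding computable_iff_recursive_on by (rule recursive_on_comp1)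

named_theorems computable_intros

lemma computable_id [computable_intros]: "computable (\<lambda>x. x)"
  and computable_const [computable_intros]: "computable (\<lambda>x. c)"
  unfolding computable_iff_recursive_on
  by (auto intro: recursive_on_proj recursive_on_const)

lemma computable_arith [computable_intros]:
  assumes "computable a" "computable b"
  shows "computable (\<lambda>x. a x + b x)" "computable (\<lambda>x. a x - b x)"
    "computable (\<lambda>x. prod_encode (a x, b x))"
  using assms unfolding computable_iff_recursive_on prod_encode_def
  by (auto intro!: recursive_on_add recursive_on_diff recursive_on_triangle)

lemma computable_unary [computable_intros]:
  assumes "computable a"
  shows "computable (\<lambda>x. Suc (a x))" "computable (\<lambda>x. fst (prod_decode (a x)))"
    "computable (\<lambda>x. snd (prod_decode (a x)))"
  using assms unfolding computable_iff_recursive_on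
  by (auto intro: recursive_on_Suc recursive_on_prod_decode)

text \<open>In the premises of the following rules, the variables bound in the conclusion
  are coded as components of one argument.\<close>

lemma computable_rec_nat [computable_intros]:
  assumes "computable a" "computable n"
    and g: "computable (\<lambda>p. g (snd (prod_decode (snd (prod_decode p))))
        (fst (prod_decode p)) (fst (prod_decode (snd (prod_decode p)))))"
  shows "computable (\<lambda>x. rec_nat (a x) (\<lambda>y z. g x y z) (n x))"
proof -
  have "recursive_on 3 (\<lambda>xs. prod_encode (xs ! 0, prod_encode (xs ! 1, xs ! 2)))"
    unfolding prod_encode_def case_prod_conv
    by (intro recursive_on_add recursive_on_triangle recursive_on_proj) auto
  from recursive_on_comp1[OF g[unfolded computable_iff_recursive_on] this]
  have "recursive_on (Suc (Suc 1)) (\<lambda>xs. g (xs ! 2) (xs ! 0) (xs ! 1))"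
    by (simp add: numeral_3_eq_3)
  from recursive_on_rec_nat[OF _ this] assms(1,2) show ?thesis
    unfolding computable_iff_recursive_on by (simp add: numeral_2_eq_2)
qed

lemma computable_mult [computable_intros]:
  assumes "computable a" "computable b"
  shows "computable (\<lambda>x. a x * b x)"
proof -
  have eq: "rec_nat 0 (\<lambda>y z. z + n) m = m * n" for m n :: nat
    by (induction m) auto
  have "computable (\<lambda>x. rec_nat 0 (\<lambda>y z. z + b x) (a x))"
    by (intro computable_intros assms computable_comp[OF assms(2)])
  then show ?thesis by (simp add: eq)
qed

lemma computable_if [computable_intros]:
  assumes "computable (\<lambda>x. of_bool (P x))" "computable a" "computable b"
  shows "computable (\<lambda>x. if P x then a x else b x)"
proof -
  have "computable (\<lambda>x. of_bool (P x) * a x + (1 - of_bool (P x)) * b x)"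
    by (intro computable_intros assms)
  also have "(\<lambda>x. of_bool (P x) * a x + (1 - of_bool (P x)) * b x) = (\<lambda>x. if P x then a x else b x)"
    by auto
  finally show ?thesis .
qed

lemma computable_Least [computable_intros]:
  assumes "computable (\<lambda>p. of_bool (P (snd (prod_decode p)) (fst (prod_decode p))))"
    and "\<And>x. \<exists>y. P x y"
  shows "computable (\<lambda>x. LEAST y. P x y)"
proof -
  have "recursive_on 2 (\<lambda>xs. prod_encode (xs ! 0, xs ! 1))"
    unfolding prod_encode_def case_prod_conv
    by (intro recursive_on_add recursive_on_triangle recursive_on_proj) auto
  from recursive_on_diff[OF recursive_on_const[of _ 1]
      recursive_on_comp1[OF assms(1)[unfolded computable_iff_recursive_on] this]]
  have "recursive_on (Suc 1) (\<lambda>xs. 1 - of_bool (P (xs ! 1) (xs ! 0)))"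
    by (simp add: numeral_2_eq_2)
  moreover have eq: "1 - of_bool Q = (0 :: nat) \<longleftrightarrow> Q" for Q
    by simp
  ultimately have "recursive_on 1
      (\<lambda>xs. LEAST y. (\<lambda>xs. 1 - of_bool (P (xs ! 1) (xs ! 0))) (y # xs) = (0 :: nat))"
    using assms(2) by (intro recursive_on_mu) simp_all
  then show ?thesis
    unfolding computable_iff_recursive_on eq by simp
qed

lemma computable_of_bool_conn [computable_intros]:
  assumes "computable (\<lambda>x. of_bool (P x))" "computable (\<lambda>x. of_bool (Q x))"
  shows "computable (\<lambda>x. of_bool (P x \<and> Q x))" "computable (\<lambda>x. of_bool (P x \<or> Q x))"
proof -
  have "computable (\<lambda>x. of_bool (P x) * of_bool (Q x))"
    "computable (\<lambda>x. of_bool (P x) + of_bool (Q x) - of_bool (P x) * of_bool (Q x))"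
    by (intro computable_intros assms)+
  moreover have "of_bool (P x) + of_bool (Q x) - of_bool (P x) * of_bool (Q x) =
    (of_bool (P x \<or> Q x) :: nat)" for x by simp
  ultimately show "computable (\<lambda>x. of_bool (P x \<and> Q x))" "computable (\<lambda>x. of_bool (P x \<or> Q x))"
    by (simp_all add: of_bool_conj)
qed

lemma computable_of_bool_compare [computable_intros]:
  assumes "computable a" "computable b"
  shows "computable (\<lambda>x. of_bool (a x \<le> b x))" "computable (\<lambda>x. of_bool (a x < b x))"
    "computable (\<lambda>x. of_bool (a x = b x))"
proof -
  have *: "computable (\<lambda>x. of_bool (a x \<le> b x))" if "computable a" "computable b" for a b
  proof -
    have "computable (\<lambda>x. 1 - (a x - b x))"
      by (intro computable_intros that)
    also have "(\<lambda>x. 1 - (a x - b x)) = (\<lambda>x. of_bool (a x \<le> b x))"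
      by (auto simp: fun_eq_iff)
    finally show ?thesis .
  qed
  show "computable (\<lambda>x. of_bool (a x \<le> b x))"
    by (intro * assms)
  show "computable (\<lambda>x. of_bool (a x < b x))"
    unfolding Suc_le_eq[symmetric] by (intro * computable_intros assms)
  show "computable (\<lambda>x. of_bool (a x = b x))"
    unfolding eq_iff by (intro * computable_intros assms)
qed

lemma computable_div [computable_intros]:
  assumes "computable a" "computable b"
  shows "computable (\<lambda>x. a x div b x)"
proof -
  \<comment> \<open>The disjunct \<open>n = 0\<close> makes the search terminate at 0 for a zero
    divisor, which agrees with \<open>m div 0 = 0\<close>.\<close>
  have eq: "(LEAST t. m < Suc t * n \<or> n = 0) = m div n" for m n :: nat
  proof (cases "n = 0")
    case False
    then have "m < Suc t * n \<or> n = 0 \<longleftrightarrow> m div n < Suc t" for t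
      by (simp add: div_less_iff_less_mult del: mult_Suc)
    then show ?thesis
      by (intro Least_equality) auto
  qed simp
  have "computable (\<lambda>x. LEAST t. a x < Suc t * b x \<or> b x = 0)"
  proof (intro computable_intros computable_comp[OF assms(1)] computable_comp[OF assms(2)])
    show "\<exists>t. a x < Suc t * b x \<or> b x = 0" for x
      by (intro exI[of _ "a x"]) (cases "b x", auto)
  qed
  then show ?thesis by (simp only: eq)
qed

lemma computable_of_bool_dvd [computable_intros]:
  assumes "computable a" "computable b"
  shows "computable (\<lambda>x. of_bool (a x dvd b x))"
proof -
  have "computable (\<lambda>x. of_bool (a x * (b x div a x) = b x))"
    by (intro computable_intros assms)
  also have "(\<lambda>x. a x * (b x div a x) = b x) = (\<lambda>x. a x dvd b x)"
    by (metis dvd_mult_div_cancel dvd_triv_left)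
  finally show ?thesis .
qed

section \<open>Traversing coded lists\<close>

lemma computable_fold [computable_intros]:
  assumes f: "computable (\<lambda>p. f (snd (prod_decode (snd (prod_decode p))))
        (fst (prod_decode p)) (fst (prod_decode (snd (prod_decode p)))))"
    and "computable l" "computable s"
  shows "computable (\<lambda>x. fold (f x) (list_decode (l x)) (s x))"
proof -
  \<comment> \<open>The state pairs the code of the unread rest of the list with the accumulator.
    The empty rest has code 0 and leaves the state unchanged; otherwise subtracting 1 exposes the
    pair of head and tail.\<close>
  define step where "step = (\<lambda>f' z. if fst (prod_decode z) = 0 then z else
      prod_encode (snd (prod_decode (fst (prod_decode z) - 1)),
        f' (fst (prod_decode (fst (prod_decode z) - 1))) (snd (prod_decode z))))"
  have iter: "rec_nat (prod_encode (list_encode xs, s)) (\<lambda>_. step f') n =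
      prod_encode (list_encode (drop n xs), fold f' (take n xs) s)" for f' xs s n
  proof (induction n)
    case (Suc n)
    show ?case
    proof (cases "n < length xs")
      case True
      then show ?thesis
        using Suc Cons_nth_drop_Suc[OF True, symmetric]
        by (simp add: step_def take_Suc_conv_app_nth)
    next
      case False
      then show ?thesis using Suc by (simp add: step_def)
    qed
  qed simp
  \<comment> \<open>The code of a list bounds its length, so it can itself serve as the number of
    iterations; the surplus ones are idle.\<close>
  have len: "length xs \<le> list_encode xs" for xs
    by (induction xs) (auto intro: order_trans[OF _ le_prod_encode_2])
  have eq: "snd (prod_decode (rec_nat (prod_encode (c, s)) (\<lambda>_. step f') c)) =
      fold f' (list_decode c) s" for c s f'
    using iter[of "list_decode c" s f' c] len[of "list_decode c"] by simp
  have f': "computable (\<lambda>x. f (d x) (a x) (b x))"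
    if "computable a" "computable b" "computable d" for a b d
    using computable_comp[OF f, of "\<lambda>x. prod_encode (a x, prod_encode (b x, d x))"]
    by (simp add: computable_intros that)
  have "computable (\<lambda>x. snd (prod_decode
      (rec_nat (prod_encode (l x, s x)) (\<lambda>_. step (f x)) (l x))))"
    unfolding step_def by (intro f' computable_intros assms(2,3))
  then show ?thesis
    by (simp add: eq)
qed

text \<open>Folding with the code of cons reverses a list onto the start value. Reversing once onto
  the empty list and once more onto the code of \<open>[b x]\<close> restores the order and puts the
  new entry last.\<close>

lemma computable_snoc [computable_intros]:
  assumes "computable a" "computable b"
  shows "computable (\<lambda>x. list_encode (list_decode (a x) @ [b x]))"
proof -
  have "fold (\<lambda>h t. Suc (prod_encode (h, t))) xs (list_encode ys) = list_encode (rev xs @ ys)"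
    for xs ys by (induction xs arbitrary: ys) (simp_all flip: list_encode.simps(2))
  note eq = this[where ys = "[]"] this[where ys = "[y]" for y]
  have "computable (\<lambda>x. fold (\<lambda>h t. Suc (prod_encode (h, t)))
      (list_decode (fold (\<lambda>h t. Suc (prod_encode (h, t))) (list_decode (a x)) 0))
      (Suc (prod_encode (b x, 0))))"
    by (intro computable_intros assms)
  then show ?thesis using eq by simp
qed

section \<open>The superfarthingale of a supermartingale\<close>

text \<open>The expectation is affine in \<open>p\<close>, so its maximum over the interval is at an
  endpoint. For rational data the bound thus reduces to two rational comparisons, which makes the
  test inside \<open>trim\<close> decidable.\<close>

lemma upper_expectation_le_iff:
  "upper_expectation I f \<le> c \<longleftrightarrow>
    (\<forall>p\<in>{lower_end I, upper_end I}. real_of_rat p * f True + (1 - real_of_rat p) * f False \<le> c)"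
    (is "_ \<longleftrightarrow> (\<forall>p\<in>_. ?g (real_of_rat p) \<le> c)")
proof
  have "{real_of_rat (lower_end I), real_of_rat (upper_end I)} \<subseteq> interval I"
    using rforecast_ends(2)[of I] by (simp add: interval_def of_rat_less_eq)
  then show "\<forall>p\<in>{lower_end I, upper_end I}. ?g (real_of_rat p) \<le> c" if "upper_expectation I f \<le> c"
    using that upper_expectation_attained[of I f] by fastforce
next
  assume ends: "\<forall>p\<in>{lower_end I, upper_end I}. ?g (real_of_rat p) \<le> c"
  obtain p where p: "p \<in> interval I" "upper_expectation I f = ?g p"
    using upper_expectation_attained by blast
  let ?l = "real_of_rat (lower_end I)" and ?u = "real_of_rat (upper_end I)"
  have lin: "?g x = f False + x * (f True - f False)" for x
    by (simp add: algebra_simps)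
  have "?g p \<le> max (?g ?l) (?g ?u)"
  proof (cases "f False \<le> f True")
    case True
    then have "?g p \<le> ?g ?u"
      unfolding lin using p(1) by (auto simp: interval_def intro!: mult_right_mono)
    then show ?thesis by simp
  next
    case False
    then have "?g p \<le> ?g ?l"
      unfolding lin using p(1) by (auto simp: interval_def intro!: mult_right_mono_neg)
    then show ?thesis by simp
  qed
  then show "upper_expectation I f \<le> c"
    using ends p(2) by auto
qed

lemma upper_expectation_ge:
  assumes "p \<in> interval I"
  shows "p * f True + (1 - p) * f False \<le> upper_expectation I f"
  using upper_expectation_attained[of I f] assms by blast

lemma upper_expectation_mono:
  assumes "\<And>x. f x \<le> g x"
  shows "upper_expectation I f \<le> upper_expectation I g"
proof -
  obtain p where p: "p \<in> interval I" "upper_expectation I f = p * f True + (1 - p) * f False"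
    using upper_expectation_attained by blast
  have "0 \<le> p" "p \<le> 1"
    using p(1) rforecast_ends(1,3)[of I] unfolding interval_def
    by (auto intro: order_trans[of 0 "real_of_rat (lower_end I)"]
        order_trans[of _ "real_of_rat (upper_end I)" 1])
  then have "upper_expectation I f \<le> p * g True + (1 - p) * g False"
    unfolding p(2) using assms by (intro add_mono mult_left_mono) auto
  also have "\<dots> \<le> upper_expectation I g"
    using p(1) by (rule upper_expectation_ge)
  finally show ?thesis .
qed

lemma upper_expectation_const: "upper_expectation I (\<lambda>_. c) = c"
  using upper_expectation_attained[of I "\<lambda>_. c"] by (auto simp: algebra_simps)

lemma upper_expectation_scale:
  assumes "0 \<le> c"
  shows "upper_expectation I (\<lambda>x. c * f x) \<le> c * upper_expectation I f"
proof -
  obtain p where p: "p \<in> interval I"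
    "upper_expectation I (\<lambda>x. c * f x) = p * (c * f True) + (1 - p) * (c * f False)"
    using upper_expectation_attained[of I "\<lambda>x. c * f x"] by blast
  have "\<dots> = c * (p * f True + (1 - p) * f False)"
    by (simp add: algebra_simps)
  also have "\<dots> \<le> c * upper_expectation I f"
    using assms p(1) by (intro mult_left_mono upper_expectation_ge)
  finally show ?thesis using p(2) by simp
qed

section \<open>Selecting the largest admissible index\<close>

text \<open>A later passing index overwrites an earlier one, so the recursion ends with the largest
  passing \<open>j\<close> up to \<open>m\<close>, or with 0 if none passes.
  \<open>trim_code\<close> repeats this recursion on codes.\<close>

definition trim :: "(nat \<Rightarrow> bool \<Rightarrow> real) \<Rightarrow> nat \<Rightarrow> rforecast \<Rightarrow> real \<Rightarrow> bool \<Rightarrow> real" where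
  "trim r m I c x = rec_nat 0 (\<lambda>j z. if upper_expectation I (r j) \<le> c then r j x else z) (Suc m)"

lemma trim_cases:
  obtains (none) "\<And>j. j \<le> m \<Longrightarrow> \<not> upper_expectation I (r j) \<le> c" "trim r m I c = (\<lambda>_. 0)"
  | (last) j where "j \<le> m" "upper_expectation I (r j) \<le> c" "trim r m I c = r j"
      "\<And>i. i \<le> m \<Longrightarrow> upper_expectation I (r i) \<le> c \<Longrightarrow> i \<le> j"
proof -
  have "(\<forall>j\<le>m. \<not> upper_expectation I (r j) \<le> c) \<and> trim r m I c = (\<lambda>_. 0) \<or>
    (\<exists>j\<le>m. upper_expectation I (r j) \<le> c \<and> trim r m I c = r j \<and>
      (\<forall>i\<le>m. upper_expectation I (r i) \<le> c \<longrightarrow> i \<le> j))"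
  proof (induction m)
    case 0
    then show ?case by (auto simp: trim_def fun_eq_iff)
  next
    case (Suc m)
    have "trim r (Suc m) I c =
        (if upper_expectation I (r (Suc m)) \<le> c then r (Suc m) else trim r m I c)"
      by (auto simp: trim_def fun_eq_iff)
    then show ?case
      using Suc by (auto simp: le_Suc_eq)
  qed
  then show ?thesis using none last by blast
qed

lemma trim_nonneg:
  assumes "\<And>j x. 0 \<le> r j x"
  shows "0 \<le> trim r m I c x"
  by (rule trim_cases[of m I r c]) (simp_all add: assms)

lemma upper_expectation_trim_le:
  assumes "0 \<le> c"
  shows "upper_expectation I (trim r m I c) \<le> c"
  by (rule trim_cases[of m I r c]) (simp_all add: assms upper_expectation_const)

lemma trim_ge:
  assumes "\<And>x. mono (\<lambda>j. r j x)" "j \<le> m" "upper_expectation I (r j) \<le> c"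
  shows "r j x \<le> trim r m I c x"
  by (rule trim_cases[of m I r c]) (use assms in \<open>auto dest: monoD\<close>)

text \<open>Raising \<open>m\<close> or \<open>c\<close> only adds admissible indices, so the
  selected index cannot decrease, and \<open>r\<close> increases with the index. If no index was
  admissible before, the old value is 0.\<close>

lemma trim_mono:
  assumes mono: "\<And>x. mono (\<lambda>j. r j x)" and nonneg: "\<And>j x. 0 \<le> r j x"
    and le: "m \<le> m'" "c \<le> c'"
  shows "trim r m I c x \<le> trim r m' I c' x"
proof (rule trim_cases[of m I r c])
  fix j assume "j \<le> m" "upper_expectation I (r j) \<le> c" "trim r m I c = r j"
  then show ?thesis
    using le trim_ge[of r j m' I c' x, OF mono] by simp
qed (simp add: trim_nonneg nonneg)

text \<open>The fold carries the outcomes read so far next to the current value, as both are needed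
  for the next trimming. \<open>approx_code\<close> imitates this single pass.\<close>

definition farthingale_approx ::
  "(nat \<Rightarrow> situation \<Rightarrow> real) \<Rightarrow> nat \<Rightarrow> preq_situation \<Rightarrow> real" where
  "farthingale_approx r m v = snd (fold (\<lambda>(I, x) (w, c).
    (w @ [x], trim (\<lambda>j x. r j (w @ [x])) m I c x)) v ([], 1))"

lemma farthingale_approx_Nil: "farthingale_approx r m [] = 1"
  by (simp add: farthingale_approx_def)

lemma farthingale_approx_snoc: "farthingale_approx r m (v @ [(I, x)]) =
  trim (\<lambda>j x. r j (map snd v @ [x])) m I (farthingale_approx r m v) x"
proof -
  have "fst (fold (\<lambda>(I, x) (w, c). (w @ [x], trim (\<lambda>j x. r j (w @ [x])) m I c x)) v s) =
      fst s @ map snd v" for s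
    by (induction v arbitrary: s) (auto simp: split_beta)
  then show ?thesis
    by (simp add: farthingale_approx_def split_beta)
qed

section \<open>The limit superfarthingale and its agreement with \<open>T\<close> along compatible
  paths\<close>

locale scaled_approximation =
  fixes q r :: "nat \<Rightarrow> situation \<Rightarrow> real" and T :: "situation \<Rightarrow> real"
  assumes q_mono: "\<And>w. mono (\<lambda>j. q j w)" and q_nonneg: "\<And>j w. 0 \<le> q j w"
    and q_lim: "\<And>w. (\<lambda>j. q j w) \<longlonglongrightarrow> T w"
    and r_def: "\<And>j w. r j w = real j / real (Suc j) * q j w"
begin

lemma q_le: "q j w \<le> T w"
  using incseq_le[of "\<lambda>j. q j w"] q_mono q_lim by simp

lemma r_nonneg: "0 \<le> r j w"
  by (simp add: r_def q_nonneg)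

lemma T_nonneg: "0 \<le> T w"
  using q_nonneg q_le order_trans by blast

lemma r_le: "r j w \<le> real j / real (Suc j) * T w"
  unfolding r_def by (intro mult_left_mono q_le) simp

lemma r_le_limit: "r j w \<le> T w"
proof -
  have "real j / real (Suc j) * T w \<le> 1 * T w"
    by (intro mult_right_mono T_nonneg) (simp add: field_simps)
  then show ?thesis using r_le[of j w] by simp
qed

lemma r_mono: "mono (\<lambda>j. r j w)"
proof (rule monoI)
  fix i j :: nat assume "i \<le> j"
  then show "r i w \<le> r j w"
    unfolding r_def
    by (intro mult_mono q_nonneg monoD[OF q_mono]) (simp_all add: field_simps)
qed

lemma r_lim: "(\<lambda>j. r j w) \<longlonglongrightarrow> T w"
  using tendsto_mult[OF LIMSEQ_n_over_Suc_n q_lim[of w]] by (simp add: r_def)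

definition limit :: "preq_situation \<Rightarrow> real" where
  "limit v = lim (\<lambda>m. farthingale_approx r m v)"

lemma approx_nonneg: "0 \<le> farthingale_approx r m v"
  by (cases v rule: rev_cases)
    (auto simp: farthingale_approx_Nil farthingale_approx_snoc intro!: trim_nonneg r_nonneg)

lemma approx_mono: "mono (\<lambda>m. farthingale_approx r m v)"
proof (rule monoI)
  fix m m' :: nat assume "m \<le> m'"
  then show "farthingale_approx r m v \<le> farthingale_approx r m' v"
    by (induction v rule: rev_induct)
      (auto simp: farthingale_approx_Nil farthingale_approx_snoc r_nonneg r_mono intro!: trim_mono)
qed

text \<open>The trimmed value is 0 or some \<open>r j\<close>, and neither exceeds \<open>T\<close>.
  This bound makes the increasing approximations converge, and it gives the upper half of
  \<open>limit_snoc\<close>.\<close>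

lemma approx_snoc_le: "farthingale_approx r m (v @ [(I, x)]) \<le> T (map snd v @ [x])"
  unfolding farthingale_approx_snoc
  by (rule trim_cases[of m I "\<lambda>j x. r j (map snd v @ [x])" "farthingale_approx r m v"])
    (simp_all add: r_le_limit T_nonneg)

lemma approx_lim: "(\<lambda>m. farthingale_approx r m v) \<longlonglongrightarrow> limit v"
proof (cases v rule: rev_cases)
  case Nil
  then show ?thesis by (simp add: limit_def farthingale_approx_Nil)
next
  case (snoc v' y)
  then have "farthingale_approx r m v \<le> T (map snd v)" for m
    using approx_snoc_le[of m v' "fst y" "snd y"] by simp
  then have "convergent (\<lambda>m. farthingale_approx r m v)"
    using approx_mono[of v]
    by (intro Bseq_mono_convergent BseqI'[of _ "T (map snd v)"])
      (auto simp: approx_nonneg dest: monoD)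
  then show ?thesis by (simp add: limit_def convergent_LIMSEQ_iff)
qed

lemma approx_le_limit: "farthingale_approx r m v \<le> limit v"
  using incseq_le[OF approx_mono approx_lim] .

lemma limit_Nil: "limit [] = 1"
  by (simp add: limit_def farthingale_approx_Nil)

lemma test_superfarthingale_limit: "test_superfarthingale limit"
  unfolding test_superfarthingale_def
proof (intro conjI allI)
  show "0 \<le> limit v" for v
    using approx_nonneg approx_le_limit order_trans by blast
  show "limit [] = 1" by (rule limit_Nil)
  fix v I
  \<comment> \<open>The maximizing \<open>p\<close> is fixed for the limit function, independently
    of \<open>m\<close>. The inequality for each approximation at this \<open>p\<close> then passes
    to the limit.\<close>
  obtain p where p: "p \<in> interval I" "upper_expectation I (\<lambda>x. limit (v @ [(I, x)])) =
      p * limit (v @ [(I, True)]) + (1 - p) * limit (v @ [(I, False)])"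
    using upper_expectation_attained by blast
  let ?F = "\<lambda>m x. farthingale_approx r m (v @ [(I, x)])"
  have "(\<lambda>m. p * ?F m True + (1 - p) * ?F m False) \<longlonglongrightarrow>
      p * limit (v @ [(I, True)]) + (1 - p) * limit (v @ [(I, False)])"
    by (intro tendsto_intros approx_lim)
  moreover have "p * ?F m True + (1 - p) * ?F m False \<le> limit v" for m
  proof -
    have "p * ?F m True + (1 - p) * ?F m False \<le> upper_expectation I (?F m)"
      using p(1) by (rule upper_expectation_ge)
    also have "\<dots> \<le> farthingale_approx r m v"
      unfolding farthingale_approx_snoc using upper_expectation_trim_le[OF approx_nonneg] by simp
    also have "\<dots> \<le> limit v" by (rule approx_le_limit)
    finally show ?thesis .
  qed
  ultimately show "upper_expectation I (\<lambda>x. limit (v @ [(I, x)])) \<le> limit v"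
    unfolding p(2) by (intro LIMSEQ_le_const2) auto
qed

text \<open>By the supermartingale inequality, the upper expectation of \<open>r j\<close> is at
  most \<open>j / (j + 1)\<close> times \<open>T (map snd v)\<close>. The approximations at
  \<open>v\<close> converge to \<open>T (map snd v)\<close>, so each \<open>r j\<close> passes the
  test for some large \<open>m\<close> and stays below the limit; letting \<open>j\<close> grow
  gives the lower bound.\<close>

lemma limit_snoc:
  assumes v: "limit v = T (map snd v)"
    and I: "upper_expectation I (\<lambda>x. T (map snd v @ [x])) \<le> T (map snd v)"
  shows "limit (v @ [(I, x)]) = T (map snd v @ [x])"
proof (rule antisym)
  show "limit (v @ [(I, x)]) \<le> T (map snd v @ [x])"
    by (rule LIMSEQ_le_const2[OF approx_lim]) (simp add: approx_snoc_le)
  have "r j (map snd v @ [x]) \<le> limit (v @ [(I, x)])" for j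
  proof -
    let ?E = "upper_expectation I (\<lambda>x. r j (map snd v @ [x]))"
    let ?t = "T (map snd v)"
    have "?E \<le> upper_expectation I (\<lambda>x. real j / real (Suc j) * T (map snd v @ [x]))"
      by (intro upper_expectation_mono r_le)
    also have "\<dots> \<le> real j / real (Suc j) * upper_expectation I (\<lambda>x. T (map snd v @ [x]))"
      by (intro upper_expectation_scale) simp
    also have "\<dots> \<le> real j / real (Suc j) * ?t"
      by (intro mult_left_mono I) simp
    finally have E: "?E \<le> real j / real (Suc j) * ?t" .
    have "\<forall>\<^sub>F m in sequentially. ?E \<le> farthingale_approx r m v"
    \<comment> \<open>The factor below 1 leaves a strict gap only if \<open>?t\<close> is positive.
      If \<open>?t\<close> is 0, then \<open>?E\<close> is at most 0 and every nonnegative value of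
      the approximation suffices.\<close>
    proof (cases "?t = 0")
      case True
      then have "?E \<le> farthingale_approx r m v" for m
        using E approx_nonneg[of m v] by simp
      then show ?thesis by simp
    next
      case False
      then have "real j / real (Suc j) * ?t < 1 * ?t"
        using T_nonneg[of "map snd v"] by (intro mult_strict_right_mono) auto
      then have "?E < limit v" using E v by simp
      from order_tendstoD(1)[OF approx_lim this] show ?thesis
        by (rule eventually_mono) simp
    qed
    then obtain m where "j \<le> m" "?E \<le> farthingale_approx r m v"
      using eventually_conj[OF eventually_ge_at_top[of j]] eventually_happens'[OF sequentially_bot] by blast
    then have "r j (map snd v @ [x]) \<le> farthingale_approx r m (v @ [(I, x)])"
      unfolding farthingale_approx_snoc
      by (intro trim_ge[where r = "\<lambda>j x. r j (map snd v @ [x])"] r_mono)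
    then show ?thesis using approx_le_limit order_trans by blast
  qed
  then show "T (map snd v @ [x]) \<le> limit (v @ [(I, x)])"
    by (intro LIMSEQ_le_const2[OF r_lim]) auto
qed

lemma limit_compatible:
  assumes "test_supermartingale \<phi> T" "compatible \<phi> (\<lambda>n. (\<iota> n, \<omega> n))"
  shows "limit (initial (\<lambda>n. (\<iota> n, \<omega> n)) n) = T (initial \<omega> n)"
proof (induction n)
  case 0
  then show ?case using assms(1) by (simp add: initial_def limit_Nil test_supermartingale_def)
next
  case (Suc n)
  have proj: "map snd (initial (\<lambda>n. (\<iota> n, \<omega> n)) n) = initial \<omega> n"
    by (simp add: initial_def)
  have "\<phi> (initial \<omega> n) = \<iota> n"
    using assms(2) by (simp add: compatible_def comp_def)
  then have "upper_expectation (\<iota> n) (\<lambda>x. T (initial \<omega> n @ [x])) \<le> T (initial \<omega> n)"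
    using assms(1) unfolding test_supermartingale_def by metis
  then show ?case
    using limit_snoc[of "initial (\<lambda>n. (\<iota> n, \<omega> n)) n" "\<iota> n" "\<omega> n"] Suc
    unfolding proj by (simp add: initial_def)
qed

end

section \<open>Computing the approximations\<close>

text \<open>\<open>int_encode\<close> sends a nonnegative integer to its double and negative
  integers to odd numbers. Parity therefore decides the sign.\<close>

definition pos_part_num :: "nat \<Rightarrow> nat" where
  "pos_part_num c = (if 2 dvd fst (prod_decode c) then fst (prod_decode c) div 2 else 0)"

definition denom :: "nat \<Rightarrow> nat" where
  "denom c = snd (prod_decode c)"

lemma computable_parts [computable_intros]:
  assumes "computable c"
  shows "computable (\<lambda>x. pos_part_num (c x))" "computable (\<lambda>x. denom (c x))"
  unfolding pos_part_num_def denom_def by (intro computable_intros assms)+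

lemma parts_rat_encode:
  shows denom_rat_encode_pos: "0 < denom (rat_encode x)"
    and pos_part_rat_encode:
      "real (pos_part_num (rat_encode x)) / real (denom (rat_encode x)) = max 0 (real_of_rat x)"
proof -
  obtain a b where ab: "quotient_of x = (a, b)" by force
  then have b: "0 < b" and x: "x = of_int a / of_int b"
    using quotient_of_denom_pos quotient_of_div by auto
  have d: "denom (rat_encode x) = nat b"
    by (simp add: rat_encode_def ab denom_def)
  then show "0 < denom (rat_encode x)" using b by simp
  have "pos_part_num (rat_encode x) = nat a"
    by (auto simp: rat_encode_def ab pos_part_num_def int_encode_def sum_encode_def)
  then show "real (pos_part_num (rat_encode x)) / real (denom (rat_encode x)) = max 0 (real_of_rat x)"
    unfolding d using b by (simp add: x of_rat_divide max_def field_simps)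
qed

text \<open>Codes of possibly unreduced fractions; only the final value is reduced.\<close>

definition fraction_code :: "nat \<Rightarrow> real \<Rightarrow> bool" where
  "fraction_code c y \<longleftrightarrow> 0 < snd (prod_decode c) \<and>
    y = real (fst (prod_decode c)) / real (snd (prod_decode c))"

lemma fraction_code_0: "fraction_code (prod_encode (0, 1)) 0"
  by (simp add: fraction_code_def)

lemma fraction_code_rec_nat:
  assumes "fraction_code a y" "\<And>j c z. fraction_code c z \<Longrightarrow> fraction_code (f j c) (g j z)"
  shows "fraction_code (rec_nat a f n) (rec_nat y g n)"
  by (induction n) (simp_all add: assms)

text \<open>\<open>rat_encode\<close> demands lowest terms. The reduced denominator of
  \<open>a / b\<close> is the least positive \<open>d\<close> with \<open>b dvd a * d\<close>;
  searching for \<open>d - 1\<close> keeps it positive, and the disjunct \<open>b = 0\<close> keeps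
  the search total. The factor 2 is the integer code of a nonnegative numerator.\<close>

definition reduce :: "nat \<Rightarrow> nat" where
  "reduce c = (let a = fst (prod_decode c); b = snd (prod_decode c);
      d = Suc (LEAST t. b dvd a * Suc t \<or> b = 0) in prod_encode (2 * (a * d div b), d))"

lemma computable_reduce [computable_intros]:
  assumes "computable c"
  shows "computable (\<lambda>x. reduce (c x))"
proof -
  have "\<exists>t. b dvd a * Suc t \<or> b = 0" for a b
    by (cases b) (auto intro!: exI[of _ "b - 1"] simp del: mult_Suc_right)
  then have "computable reduce"
    unfolding reduce_def Let_def by (intro computable_intros)
  then show ?thesis using assms by (rule computable_comp)
qed

lemma reduce_fraction_code:
  assumes "fraction_code c y"
  obtains x where "reduce c = rat_encode x" "real_of_rat x = y"
proof -
  obtain a b where c: "prod_decode c = (a, b)" by force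
  with assms have b: "0 < b" and y: "y = real a / real b"
    by (auto simp: fraction_code_def)
  let ?x = "of_nat a / of_nat b :: rat"
  obtain p q where pq: "quotient_of ?x = (p, q)" by force
  then have q: "0 < q" and x: "?x = of_int p / of_int q" and cop: "coprime p q"
    using quotient_of_denom_pos quotient_of_div quotient_of_coprime by auto
  have "of_nat a * of_int q = (of_int p * of_nat b :: rat)"
    using x b q by (simp add: field_simps)
  then have eq: "int a * q = p * int b"
    by (metis of_int_eq_iff of_int_mult of_int_of_nat_eq)
  then have "0 \<le> p * int b"
    using q by (simp flip: eq)
  then have "0 \<le> p"
    using b by (simp add: zero_le_mult_iff)
  then obtain n d where nd: "p = int n" "q = int d"
    using q by (metis less_imp_le nonneg_int_cases)
  have eq': "a * d = n * b" and cop': "coprime n d" and d: "0 < d"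
    using eq cop q unfolding nd by (simp_all flip: of_nat_mult)
  \<comment> \<open>Since \<open>a * d = n * b\<close>, divisibility of \<open>a * Suc t\<close> by
    \<open>b\<close> yields \<open>d dvd n * Suc t\<close>, and coprimality of \<open>n\<close> and
    \<open>d\<close> leaves \<open>d dvd Suc t\<close>. Hence no smaller multiplier works.\<close>
  have "(LEAST t. b dvd a * Suc t \<or> b = 0) = d - 1"
  proof (rule Least_equality)
    show "b dvd a * Suc (d - 1) \<or> b = 0" using d eq' by simp
    fix t assume "b dvd a * Suc t \<or> b = 0"
    then obtain s where "a * Suc t = b * s" using b by (auto simp del: mult_Suc_right)
    then have "d * (b * s) = d * (a * Suc t)" by (simp only:)
    also have "\<dots> = (a * d) * Suc t" by (simp only: ac_simps)
    finally have "d * (b * s) = (a * d) * Suc t" .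
    then have "b * (d * s) = b * (n * Suc t)" unfolding eq' by (simp only: ac_simps)
    then have "n * Suc t = d * s" using b by (simp only: mult_cancel1) simp
    then have "d dvd n * Suc t" by (simp only: dvd_triv_left)
    then have "d dvd Suc t"
      using coprime_dvd_mult_right_iff[of d n] cop' coprime_commute by blast
    then show "d - 1 \<le> t" using dvd_imp_le[of d "Suc t"] by simp
  qed
  then have "reduce c = prod_encode (2 * n, d)"
    using d b eq' by (simp add: reduce_def c del: mult_Suc_right)
  also have "\<dots> = rat_encode ?x"
    by (simp add: rat_encode_def pq nd int_encode_def sum_encode_def)
  finally have "reduce c = rat_encode ?x" .
  moreover have "real_of_rat ?x = y"
    by (simp add: y of_rat_divide)
  ultimately show thesis by (rule that)
qed

text \<open>This is the inequality p u + (1 - p) v \<le> w multiplied by all denominators, so that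
  it lives in the natural numbers. Truncated subtraction does no harm when p is at most 1.\<close>

definition mixture_le :: "nat \<Rightarrow> nat \<Rightarrow> nat \<Rightarrow> nat \<Rightarrow> bool" where
  "mixture_le p a b c \<longleftrightarrow>
    (pos_part_num p * fst (prod_decode a) * snd (prod_decode b) +
      (denom p - pos_part_num p) * fst (prod_decode b) * snd (prod_decode a)) * snd (prod_decode c)
    \<le> fst (prod_decode c) * (denom p * snd (prod_decode a) * snd (prod_decode b))"

lemma computable_mixture_le [computable_intros]:
  assumes "computable p" "computable a" "computable b" "computable c"
  shows "computable (\<lambda>x. of_bool (mixture_le (p x) (a x) (b x) (c x)))"
  unfolding mixture_le_def by (intro computable_intros assms)

lemma mixture_le_iff:
  assumes p: "0 \<le> p" "p \<le> 1"
    and "fraction_code a u" "fraction_code b v" "fraction_code c w"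
  shows "mixture_le (rat_encode p) a b c \<longleftrightarrow>
    real_of_rat p * u + (1 - real_of_rat p) * v \<le> w"
proof -
  define N D where "N = pos_part_num (rat_encode p)" and "D = denom (rat_encode p)"
  obtain a1 a2 b1 b2 c1 c2 where codes:
    "prod_decode a = (a1, a2)" "prod_decode b = (b1, b2)" "prod_decode c = (c1, c2)"
    by (metis surj_pair)
  have pos: "0 < a2" "0 < b2" "0 < c2" "0 < D"
    and vals: "u = real a1 / real a2" "v = real b1 / real b2" "w = real c1 / real c2"
    using assms by (auto simp: fraction_code_def codes D_def denom_rat_encode_pos)
  have P: "real_of_rat p = real N / real D"
    using pos_part_rat_encode[of p] p(1) by (simp add: N_def D_def)
  then have ND: "N \<le> D"
    using p(2) pos(4) by (metis divide_le_eq_1_pos of_nat_0_less_iff of_nat_le_iff of_rat_le_1_iff)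
  have "mixture_le (rat_encode p) a b c \<longleftrightarrow>
    real ((N * a1 * b2 + (D - N) * b1 * a2) * c2) \<le> real (c1 * (D * a2 * b2))"
    unfolding mixture_le_def codes of_nat_le_iff by (simp add: N_def D_def)
  also have "\<dots> \<longleftrightarrow> (real N * a1 * b2 + (real D - N) * b1 * a2) * c2 \<le> c1 * (real D * a2 * b2)"
    using ND by (simp add: of_nat_diff)
  also have "\<dots> \<longleftrightarrow> real_of_rat p * u + (1 - real_of_rat p) * v \<le> w"
  proof -
    have "real_of_rat p * u + (1 - real_of_rat p) * v =
      (real N * a1 * b2 + (real D - N) * b1 * a2) / (real D * a2 * b2)"
      using pos unfolding P vals by (simp add: field_simps)
    then show ?thesis
      unfolding vals using pos by (simp add: divide_le_eq le_divide_eq mult.commute)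
  qed
  finally show ?thesis .
qed

section \<open>The approximations on codes\<close>

context
  fixes G :: "nat \<Rightarrow> nat"
begin

definition scaled_code :: "nat \<Rightarrow> nat \<Rightarrow> nat" where
  "scaled_code j u = prod_encode (j * pos_part_num (G (prod_encode (u, j))),
    Suc j * denom (G (prod_encode (u, j))))"

text \<open>The code \<open>I\<close> is a pair of endpoint codes, and the two tests are those of
  \<open>upper_expectation_le_iff\<close>, with outcomes 1 and 0 appended to \<open>u\<close>. The
  start value codes the fraction 0/1.\<close>

definition trim_code :: "nat \<Rightarrow> nat \<Rightarrow> nat \<Rightarrow> nat \<Rightarrow> nat \<Rightarrow> nat" where
  "trim_code m I u c x = rec_nat (prod_encode (0, 1))
    (\<lambda>j z. if mixture_le (fst (prod_decode I))
          (scaled_code j (list_encode (list_decode u @ [1])))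
          (scaled_code j (list_encode (list_decode u @ [0]))) c \<and>
        mixture_le (snd (prod_decode I))
          (scaled_code j (list_encode (list_decode u @ [1])))
          (scaled_code j (list_encode (list_decode u @ [0]))) c
      then scaled_code j (list_encode (list_decode u @ [x])) else z) (Suc m)"

definition step_code :: "nat \<Rightarrow> nat \<Rightarrow> nat \<Rightarrow> nat" where
  "step_code m e z = prod_encode
    (list_encode (list_decode (fst (prod_decode z)) @ [snd (prod_decode e)]),
     trim_code m (fst (prod_decode e)) (fst (prod_decode z)) (snd (prod_decode z))
       (snd (prod_decode e)))"

text \<open>The initial state holds the empty list of outcomes, coded by 0, and the fraction 1/1,
  the value at the empty situation.\<close>

definition approx_code :: "nat \<Rightarrow> nat \<Rightarrow> nat" where
  "approx_code m v = snd (prod_decode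
    (fold (step_code m) (list_decode v) (prod_encode (0, prod_encode (1, 1)))))"

context
  assumes G: "computable G"
begin

lemma computable_scaled_code:
  assumes "computable j" "computable u"
  shows "computable (\<lambda>x. scaled_code (j x) (u x))"
  unfolding scaled_code_def by (intro computable_comp[OF G] computable_intros assms)

lemma computable_trim_code:
  assumes "computable m" "computable I" "computable u" "computable c" "computable x"
  shows "computable (\<lambda>n. trim_code (m n) (I n) (u n) (c n) (x n))"
  unfolding trim_code_def
  by (intro computable_scaled_code computable_intros assms assms[THEN computable_comp])

lemma computable_approx_code: "computable (\<lambda>n. approx_code (snd (prod_decode n)) (fst (prod_decode n)))"
  unfolding approx_code_def step_code_def by (intro computable_trim_code computable_intros)

end

context
  fixes q :: "situation \<times> nat \<Rightarrow> rat" and r :: "nat \<Rightarrow> situation \<Rightarrow> real"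
  assumes G: "\<And>w j. G (prod_encode (situation_encode w, j)) = rat_encode (q (w, j))"
    and r: "\<And>j w. r j w = real j / real (Suc j) * max 0 (real_of_rat (q (w, j)))"
begin

lemma fraction_code_scaled: "fraction_code (scaled_code j (situation_encode w)) (r j w)"
  unfolding fraction_code_def scaled_code_def G r pos_part_rat_encode[symmetric]
  by (simp add: denom_rat_encode_pos del: of_nat_Suc mult_Suc)

lemma fraction_code_trim:
  assumes c: "fraction_code c y"
  shows "fraction_code (trim_code m (rforecast_encode I) (situation_encode w) c (of_bool x))
    (trim (\<lambda>j x. r j (w @ [x])) m I y x)"
proof -
  have snoc: "list_encode (list_decode (situation_encode w) @ [of_bool b]) =
      situation_encode (w @ [b])" for b
    by (simp add: situation_encode_def)
  note snoc' = snoc snoc[of True, unfolded of_bool_eq] snoc[of False, unfolded of_bool_eq]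
  have test: "mixture_le (rat_encode p) (scaled_code j (situation_encode (w @ [True])))
      (scaled_code j (situation_encode (w @ [False]))) c \<longleftrightarrow>
      real_of_rat p * r j (w @ [True]) + (1 - real_of_rat p) * r j (w @ [False]) \<le> y"
    if "p \<in> {lower_end I, upper_end I}" for p j
    using that rforecast_ends[of I]
    by (intro mixture_le_iff fraction_code_scaled c) auto
  show ?thesis
    unfolding trim_code_def trim_def rforecast_encode_def prod_encode_inverse fst_conv snd_conv
      snoc' upper_expectation_le_iff
    by (rule fraction_code_rec_nat)
      (simp_all add: test fraction_code_scaled fraction_code_0[simplified])
qed

lemma fraction_code_approx:
  "fraction_code (approx_code m (preq_situation_encode v)) (farthingale_approx r m v)"
proof -
  \<comment> \<open>The induction has to follow the whole state, including the coded outcomes. The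
    second component is only asserted to exist, since an unreduced fraction is not determined by its
    value.\<close>
  have "\<exists>c. fold (step_code m) (map (\<lambda>(I, x). prod_encode (rforecast_encode I, of_bool x)) v)
        (prod_encode (0, prod_encode (1, 1))) = prod_encode (situation_encode (map snd v), c) \<and>
      fraction_code c (farthingale_approx r m v)"
  proof (induction v rule: rev_induct)
    case Nil
    then show ?case
      by (simp add: situation_encode_def farthingale_approx_Nil fraction_code_def)
  next
    case (snoc e v)
    then obtain c where c: "fold (step_code m)
        (map (\<lambda>(I, x). prod_encode (rforecast_encode I, of_bool x)) v)
        (prod_encode (0, prod_encode (1, 1))) = prod_encode (situation_encode (map snd v), c)"
      "fraction_code c (farthingale_approx r m v)" by blast
    obtain I x where e: "e = (I, x)" by force
    have "step_code m (prod_encode (rforecast_encode I, of_bool x))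
        (prod_encode (situation_encode (map snd v), c)) =
      prod_encode (situation_encode (map snd (v @ [e])),
        trim_code m (rforecast_encode I) (situation_encode (map snd v)) c (of_bool x))"
      by (simp add: step_code_def e situation_encode_def)
    then show ?case
      using c(1) fraction_code_trim[OF c(2), of m I "map snd v" x]
      by (simp add: e farthingale_approx_snoc del: One_nat_def)
  qed
  then show ?thesis
    by (auto simp: approx_code_def preq_situation_encode_def)
qed

end

end

theorem proposition5:
  fixes \<iota> :: "nat \<Rightarrow> rforecast" and \<omega> :: path and \<phi> :: forecasting_system
  assumes "game_random (\<lambda>n. (\<iota> n, \<omega> n))"
    and "compatible \<phi> (\<lambda>n. (\<iota> n, \<omega> n))"
  shows "martin_loef_random \<phi> \<omega>"
  unfolding martin_loef_random_def
proof (intro allI impI, elim conjE)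
  fix T assume T: "test_supermartingale \<phi> T" "lower_semicomputable situation_encode T"
  then obtain q where q: "recursive_map (\<lambda>(d, n). prod_encode (situation_encode d, n)) rat_encode q"
    "\<And>w n. q (w, n) \<le> q (w, Suc n)" "\<And>w. (\<lambda>m. real_of_rat (q (w, m))) \<longlonglongrightarrow> T w"
    unfolding lower_semicomputable_def by blast
  from q(1) obtain g where g: "recursive 1 g"
    "\<And>x. g [(\<lambda>(d, n). prod_encode (situation_encode d, n)) x] = rat_encode (q x)"
    unfolding recursive_map_def by blast
  define G where "G x = g [x]" for x
  have G: "computable G" "\<And>w j. G (prod_encode (situation_encode w, j)) = rat_encode (q (w, j))"
    using g(1) g(2)[of "(w, j)" for w j] by (auto simp: G_def computable_def)
  define r where "r j w = real j / real (Suc j) * max 0 (real_of_rat (q (w, j)))" for j w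
  have nonneg: "0 \<le> T w" for w
    using T(1) by (simp add: test_supermartingale_def)
  interpret scaled_approximation "\<lambda>j w. max 0 (real_of_rat (q (w, j)))" r T
  \<comment> \<open>Replacing negative approximations by 0 preserves monotonicity, and also the
    limit, because \<open>T\<close> is nonnegative.\<close>
  proof
    show "mono (\<lambda>j. max 0 (real_of_rat (q (w, j))))" for w
      using q(2)[of w] by (auto simp: mono_iff_le_Suc of_rat_less_eq intro: max.coboundedI2)
    show "(\<lambda>j. max 0 (real_of_rat (q (w, j)))) \<longlonglongrightarrow> T w" for w
      using tendsto_max[OF tendsto_const q(3), of 0 w] nonneg[of w] by (simp add: max_absorb2)
  qed (simp_all add: r_def)
  have "\<exists>x. reduce (approx_code G m (preq_situation_encode v)) = rat_encode x \<and>
      real_of_rat x = farthingale_approx r m v" for v m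
    using reduce_fraction_code[OF fraction_code_approx[OF G(2) r_def]] by metis
  note ex = this
  \<comment> \<open>Lower semicomputability asks for a map into the rationals. Each approximate
    value is a rational whose code is the reduced fraction, so choice recovers the rational from
    it.\<close>
  define s where "s = (\<lambda>(v, m). SOME x. reduce (approx_code G m (preq_situation_encode v)) =
    rat_encode x \<and> real_of_rat x = farthingale_approx r m v)"
  have s: "reduce (approx_code G m (preq_situation_encode v)) = rat_encode (s (v, m))"
    "real_of_rat (s (v, m)) = farthingale_approx r m v" for v m
    using someI_ex[OF ex[of m v]] by (simp_all add: s_def)
  have "lower_semicomputable preq_situation_encode limit"
    unfolding lower_semicomputable_def
  proof (intro exI[of _ s] conjI allI)
    have "computable (\<lambda>n. reduce (approx_code G (snd (prod_decode n)) (fst (prod_decode n))))"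
      by (intro computable_intros computable_approx_code G(1))
    then show "recursive_map (\<lambda>(d, n). prod_encode (preq_situation_encode d, n)) rat_encode s"
      unfolding computable_def recursive_map_def by (auto simp: s(1))
    show "s (v, m) \<le> s (v, Suc m)" for v m
      using monoD[OF approx_mono, of m "Suc m" v] by (simp flip: s(2) add: of_rat_less_eq)
    show "(\<lambda>m. real_of_rat (s (v, m))) \<longlonglongrightarrow> limit v" for v
      unfolding s(2) by (rule approx_lim)
  qed
  then have "limsup (\<lambda>n. ereal (limit (initial (\<lambda>n. (\<iota> n, \<omega> n)) n))) < \<infinity>"
    using assms(1) test_superfarthingale_limit unfolding game_random_def by blast
  then show "limsup (\<lambda>n. ereal (T (initial \<omega> n))) < \<infinity>"
    by (simp only: limit_compatible[OF T(1) assms(2)])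
qed

end
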